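(* For all $n\ge1$, $$\det_{\mathbb C^l}\bigl(\Phi_n^R(z)\bigr)=\det_{\mathcal V_{n-1}}\bigl(z\mathbf 1-\pi_{n-1}M_z\pi_{n-1}\bigr),$$ where the right-hand determinant is that of an operator on the finite-dimensional space $\mathcal V_{n-1}$.
   Context: Fix $l\ge1$; $^\dagger$ is the Hermitian adjoint and $\mathbf 1$ denotes an identity operator. $d\mu$ is a positive semi-definite $l\times l$ matrix-valued measure on $\partial\mathbb D$, the unit circle, with $\mu(\partial\mathbb D)=\mathbf 1$. For matrix polynomials $f,g$, $\langle\!\langle f,g\rangle\!\rangle_R=\int f(e^{i\theta})^\dagger\,d\mu(\theta)\,g(e^{i\theta})$. $\mu$ is assumed non-trivial: $\operatorname{Tr}\langle\!\langle f,f\rangle\!\rangle_R>0$ for every non-zero matrix polynomial $f$. $\Phi_n^R$ is the unique monic matrix polynomial $z^n\mathbf 1+$ lower order with $\langle\!\langle z^k\mathbf 1,\Phi_n^R\rangle\!\rangle_R=0$ for $k=0,\dots,n-1$. $\mathcal V_n$ is the space of $\mathbb C^l$-valued polynomials of degree at most $n$ (of dimension $l(n+1)$), with the scalar inner product $\langle f,g\rangle=\int f(e^{i\theta})^\dagger\,d\mu(\theta)\,g(e^{i\theta})$ for column-vector-valued $f,g$. $\pi_n$ is the orthogonal projection onto $\mathcal V_n$ in this inner product, and $M_z$ is the operator of multiplication by $z$ on $\mathbb C^l$-valued polynomials. *)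

theory Defs
  imports
    "Jordan_Normal_Form.Determinant"
    "HOL-Library.Complex_Order"
    "HOL-Analysis.Analysis"
begin

hide_const (open) Matrix.vec Matrix.mat Matrix.row Matrix.col Determinant.det
no_notation Matrix.vec_index (infixl \<open>$\<close> 100)


section \<open>Integration against real and complex valued measures\<close>

definition sigma_additive :: "'a measure \<Rightarrow> ('a set \<Rightarrow> 'b::real_normed_vector) \<Rightarrow> bool" where
  "sigma_additive M \<nu> \<longleftrightarrow>
     (\<forall>A. range A \<subseteq> sets M \<longrightarrow> disjoint_family A \<longrightarrow> (\<lambda>i::nat. \<nu> (A i)) sums \<nu> (\<Union>i. A i))"

text \<open>Jordan decomposition of a signed measure: its positive part is
  \<open>A \<mapsto> sup {\<nu> B | B \<subseteq> A}\<close>, and its negative part is the positive part of \<open>-\<nu>\<close>.\<close>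

definition pos_variation :: "'a measure \<Rightarrow> ('a set \<Rightarrow> real) \<Rightarrow> 'a set \<Rightarrow> real" where
  "pos_variation M \<nu> A = (SUP B\<in>{B \<in> sets M. B \<subseteq> A}. \<nu> B)"

definition pos_part :: "'a measure \<Rightarrow> ('a set \<Rightarrow> real) \<Rightarrow> 'a measure" where
  "pos_part M \<nu> = measure_of (space M) (sets M) (\<lambda>A. ennreal (pos_variation M \<nu> A))"

definition signed_integral :: "'a measure \<Rightarrow> ('a set \<Rightarrow> real) \<Rightarrow> ('a \<Rightarrow> complex) \<Rightarrow> complex" where
  "signed_integral M \<nu> h =
     integral\<^sup>L (pos_part M \<nu>) h - integral\<^sup>L (pos_part M (\<lambda>A. - \<nu> A)) h"

definition complex_integral :: "'a measure \<Rightarrow> ('a set \<Rightarrow> complex) \<Rightarrow> ('a \<Rightarrow> complex) \<Rightarrow> complex" where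
  "complex_integral M \<nu> h =
     signed_integral M (\<lambda>A. Re (\<nu> A)) h + \<i> * signed_integral M (\<lambda>A. Im (\<nu> A)) h"

lemma pos_variation_upper:
  assumes "\<And>A. A \<in> sets M \<Longrightarrow> \<nu> A \<le> C" "B \<in> sets M" "B \<subseteq> A"
  shows "\<nu> B \<le> pos_variation M \<nu> A"
  unfolding pos_variation_def
  by (rule cSUP_upper, use assms in simp, rule bdd_aboveI2[where M = C], use assms in simp)

lemma pos_variation_least:
  assumes "\<And>B. B \<in> sets M \<Longrightarrow> B \<subseteq> A \<Longrightarrow> \<nu> B \<le> c"
  shows "pos_variation M \<nu> A \<le> c"
  unfolding pos_variation_def using assms by (intro cSUP_least) auto

lemma sigma_additive_empty:
  assumes "sigma_additive M \<nu>"
  shows "\<nu> {} = 0"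
proof -
  have "(\<lambda>i::nat. \<nu> {}) sums \<nu> (\<Union>i::nat. {})"
    using assms[unfolded sigma_additive_def, rule_format, of "\<lambda>_. {}"]
    by (auto simp: disjoint_family_on_def)
  then have "summable (\<lambda>i::nat. \<nu> {})" by (rule sums_summable)
  then show ?thesis by (simp add: summable_const_iff)
qed

lemma sigma_additive_Un:
  assumes \<nu>: "sigma_additive M \<nu>" and AB: "A \<in> sets M" "B \<in> sets M" "A \<inter> B = {}"
  shows "\<nu> (A \<union> B) = \<nu> A + \<nu> B"
proof -
  have "range (binaryset A B) \<subseteq> sets M" "disjoint_family (binaryset A B)"
    using AB by (auto simp: binaryset_def disjoint_family_on_def)
  then have "(\<lambda>i. \<nu> (binaryset A B i)) sums \<nu> (A \<union> B)"
    using \<nu> unfolding sigma_additive_def by (metis UN_binaryset_eq)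
  moreover have "(\<lambda>i. \<nu> (binaryset A B i)) sums (\<nu> A + \<nu> B)"
    using sigma_additive_empty[OF \<nu>] by (rule binaryset_sums)
  ultimately show ?thesis by (rule sums_unique2)
qed

text \<open>For a finite signed measure, \<open>pos_variation\<close> is indeed countably additive, so
  \<open>pos_part\<close> is the measure one expects.\<close>

lemma emeasure_pos_part:
  assumes \<nu>: "sigma_additive M \<nu>" and C: "\<And>A. A \<in> sets M \<Longrightarrow> \<nu> A \<le> C"
    and A: "A \<in> sets M"
  shows "emeasure (pos_part M \<nu>) A = ennreal (pos_variation M \<nu> A)"
proof -
  let ?v = "pos_variation M \<nu>"
  have nonneg: "0 \<le> ?v X" for X
    using pos_variation_upper[of M \<nu> C "{}" X, OF C] sigma_additive_empty[OF \<nu>] by auto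
  have add: "?v X + ?v Y \<le> ?v (X \<union> Y)" if "X \<inter> Y = {}" for X Y
  proof -
    have "?v X \<le> ?v (X \<union> Y) - ?v Y"
    proof (rule pos_variation_least)
      fix B assume B: "B \<in> sets M" "B \<subseteq> X"
      have "?v Y \<le> ?v (X \<union> Y) - \<nu> B"
      proof (rule pos_variation_least)
        fix D assume D: "D \<in> sets M" "D \<subseteq> Y"
        have "\<nu> (B \<union> D) = \<nu> B + \<nu> D"
          using B D that by (intro sigma_additive_Un[OF \<nu>]) auto
        moreover have "\<nu> (B \<union> D) \<le> ?v (X \<union> Y)"
          using B D by (intro pos_variation_upper[of M \<nu> C, OF C]) auto
        ultimately show "\<nu> D \<le> ?v (X \<union> Y) - \<nu> B" by simp
      qed
      then show "\<nu> B \<le> ?v (X \<union> Y) - ?v Y" by simp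
    qed
    then show ?thesis by simp
  qed
  have mono: "?v X \<le> ?v Y" if "X \<subseteq> Y" for X Y
    using that by (intro pos_variation_least pos_variation_upper[of M \<nu> C, OF C]) auto
  have ca: "countably_additive (sets M) (\<lambda>A. ennreal (?v A))"
    unfolding countably_additive_def
  proof (intro allI impI)
    fix F :: "nat \<Rightarrow> 'a set"
    assume F: "range F \<subseteq> sets M" "disjoint_family F" "\<Union> (range F) \<in> sets M"
    let ?U = "\<Union> (range F)"
    have fin: "(\<Sum>i<n. ?v (F i)) \<le> ?v (\<Union>i<n. F i)" for n
    proof (induction n)
      case 0 show ?case using nonneg by simp
    next
      case (Suc n)
      have "(\<Union>i<n. F i) \<inter> F n = {}"
      proof -
        have "F i \<inter> F n = {}" if "i < n" for i
          using that disjoint_family_onD[OF F(2), of i n] by simp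
        then show ?thesis by blast
      qed
      from add[OF this] Suc.IH show ?case by (simp add: lessThan_Suc Un_commute)
    qed
    have part: "(\<Sum>i<n. ?v (F i)) \<le> ?v ?U" for n
      by (rule order.trans[OF fin mono]) auto
    have summ: "summable (\<lambda>i. ?v (F i))"
      by (rule summableI_nonneg_bounded[OF nonneg part])
    have le: "(\<Sum>i. ?v (F i)) \<le> ?v ?U"
      by (rule suminf_le_const[OF summ part])
    have "?v ?U \<le> (\<Sum>i. ?v (F i))"
    proof (rule pos_variation_least)
      fix B assume B: "B \<in> sets M" "B \<subseteq> ?U"
      have "disjoint_family (\<lambda>i. B \<inter> F i)"
        by (rule disjoint_family_subset[OF F(2)]) auto
      moreover have "range (\<lambda>i. B \<inter> F i) \<subseteq> sets M"
        using B F(1) by auto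
      ultimately have "(\<lambda>i. \<nu> (B \<inter> F i)) sums \<nu> (\<Union>i. B \<inter> F i)"
        using \<nu> unfolding sigma_additive_def by blast
      also have "(\<Union>i. B \<inter> F i) = B" using B by auto
      finally have s: "(\<lambda>i. \<nu> (B \<inter> F i)) sums \<nu> B" .
      have "\<nu> (B \<inter> F i) \<le> ?v (F i)" for i
        using B F by (intro pos_variation_upper[of M \<nu> C, OF C]) auto
      from suminf_le[OF this sums_summable[OF s] summ] show "\<nu> B \<le> (\<Sum>i. ?v (F i))"
        using s by (simp add: sums_iff)
    qed
    with le have "(\<Sum>i. ?v (F i)) = ?v ?U" by simp
    then show "(\<Sum>i. ennreal (?v (F i))) = ennreal (?v ?U)"
      using suminf_ennreal2[OF nonneg summ] by simp
  qed
  have pos: "positive (sets M) (\<lambda>A. ennreal (?v A))"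
  proof -
    have "?v {} \<le> 0"
      using sigma_additive_empty[OF \<nu>] by (intro pos_variation_least) auto
    then show ?thesis by (simp add: positive_def ennreal_neg)
  qed
  show ?thesis
    unfolding pos_part_def
    using sets.sigma_algebra_axioms pos ca A by (rule emeasure_measure_of_sigma)
qed

lemma pos_variation_diff:
  assumes \<nu>: "sigma_additive M \<nu>" and C: "\<And>A. A \<in> sets M \<Longrightarrow> \<bar>\<nu> A\<bar> \<le> C"
    and A: "A \<in> sets M"
  shows "pos_variation M \<nu> A - pos_variation M (\<lambda>A. - \<nu> A) A = \<nu> A"
proof -
  have C1: "\<And>A. A \<in> sets M \<Longrightarrow> \<nu> A \<le> C" and C2: "\<And>A. A \<in> sets M \<Longrightarrow> - \<nu> A \<le> C"
    using C by (auto simp: abs_le_iff)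
  have split: "\<nu> A = \<nu> B + \<nu> (A - B)" if "B \<in> sets M" "B \<subseteq> A" for B
  proof -
    have "\<nu> (B \<union> (A - B)) = \<nu> B + \<nu> (A - B)"
      using that A by (intro sigma_additive_Un[OF \<nu>]) auto
    then show ?thesis using that by (simp add: Un_absorb1)
  qed
  have "pos_variation M \<nu> A \<le> \<nu> A + pos_variation M (\<lambda>A. - \<nu> A) A"
  proof (rule pos_variation_least)
    fix B assume B: "B \<in> sets M" "B \<subseteq> A"
    have "- \<nu> (A - B) \<le> pos_variation M (\<lambda>A. - \<nu> A) A"
      by (rule pos_variation_upper[where \<nu> = "\<lambda>A. - \<nu> A" and C = C]) (use C2 A B in auto)
    then show "\<nu> B \<le> \<nu> A + pos_variation M (\<lambda>A. - \<nu> A) A" using split[OF B] by simp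
  qed
  moreover have "pos_variation M (\<lambda>A. - \<nu> A) A \<le> pos_variation M \<nu> A - \<nu> A"
  proof (rule pos_variation_least)
    fix B assume B: "B \<in> sets M" "B \<subseteq> A"
    have "\<nu> (A - B) \<le> pos_variation M \<nu> A"
      using A B by (intro pos_variation_upper[of M \<nu> C, OF C1]) auto
    then show "- \<nu> B \<le> pos_variation M \<nu> A - \<nu> A" using split[OF B] by simp
  qed
  ultimately show ?thesis by simp
qed

lemma signed_integral_indicator:
  assumes \<nu>: "sigma_additive M \<nu>" and C: "\<And>A. A \<in> sets M \<Longrightarrow> \<bar>\<nu> A\<bar> \<le> C"
    and A: "A \<in> sets M"
  shows "signed_integral M \<nu> (indicator A) = of_real (\<nu> A)"
proof -
  have \<nu>': "sigma_additive M (\<lambda>A. - \<nu> A)"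
    using \<nu> by (auto simp: sigma_additive_def intro!: sums_minus)
  have C1: "\<And>A. A \<in> sets M \<Longrightarrow> \<nu> A \<le> C" and C2: "\<And>A. A \<in> sets M \<Longrightarrow> - \<nu> A \<le> C"
    using C by (auto simp: abs_le_iff)
  have *: "integral\<^sup>L (pos_part M \<rho>) (indicator A) = (of_real (pos_variation M \<rho> A) :: complex)"
    if \<rho>: "sigma_additive M \<rho>" and D: "\<And>A. A \<in> sets M \<Longrightarrow> \<rho> A \<le> C" for \<rho>
  proof -
    have "0 \<le> pos_variation M \<rho> A"
      using pos_variation_upper[of M \<rho> C "{}" A, OF D] sigma_additive_empty[OF \<rho>] by auto
    moreover have "A \<subseteq> space (pos_part M \<rho>)"
      using sets.sets_into_space[OF A] by (simp add: pos_part_def space_measure_of_conv)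
    moreover have "(indicator A :: _ \<Rightarrow> complex) = (\<lambda>x. of_real (indicator A x))"
      by (auto simp: indicator_def fun_eq_iff)
    ultimately show ?thesis
      using emeasure_pos_part[OF \<rho> D A]
      by (simp add: measure_def Int_absorb2)
  qed
  show ?thesis
    unfolding signed_integral_def
    by (simp add: *[OF \<nu> C1] *[OF \<nu>' C2] pos_variation_diff[OF \<nu> C A] flip: of_real_diff)
qed

lemma complex_integral_indicator:
  assumes \<nu>: "sigma_additive M \<nu>" and C: "\<And>A. A \<in> sets M \<Longrightarrow> cmod (\<nu> A) \<le> C"
    and A: "A \<in> sets M"
  shows "complex_integral M \<nu> (indicator A) = \<nu> A"
proof -
  have re: "sigma_additive M (\<lambda>A. Re (\<nu> A))" and im: "sigma_additive M (\<lambda>A. Im (\<nu> A))"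
    using \<nu> by (auto simp: sigma_additive_def intro: sums_Re sums_Im)
  have re_le: "\<And>A. A \<in> sets M \<Longrightarrow> \<bar>Re (\<nu> A)\<bar> \<le> C"
    and im_le: "\<And>A. A \<in> sets M \<Longrightarrow> \<bar>Im (\<nu> A)\<bar> \<le> C"
    using C abs_Re_le_cmod abs_Im_le_cmod order.trans by blast+
  show ?thesis
    using signed_integral_indicator[of M "\<lambda>A. Re (\<nu> A)" C A, OF re re_le A]
      signed_integral_indicator[of M "\<lambda>A. Im (\<nu> A)" C A, OF im im_le A]
    by (simp add: complex_integral_def complex_eq_iff)
qed


section \<open>Matrix-valued measures on the unit circle\<close>

definition hermitian_adjoint :: "complex^'n^'m \<Rightarrow> complex^'m^'n" where
  "hermitian_adjoint A = (\<chi> i j. cnj (A $ j $ i))"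

definition positive_semidefinite :: "complex^'n^'n \<Rightarrow> bool" where
  "positive_semidefinite A \<longleftrightarrow>
     hermitian_adjoint A = A \<and> (\<forall>v. 0 \<le> (\<Sum>i\<in>UNIV. \<Sum>j\<in>UNIV. cnj (v $ i) * A $ i $ j * v $ j))"

abbreviation unit_circle :: "complex measure" where
  "unit_circle \<equiv> restrict_space borel (sphere 0 1)"

definition matrix_measure :: "(complex set \<Rightarrow> complex^'l^'l) \<Rightarrow> bool" where
  "matrix_measure \<mu> \<longleftrightarrow>
     sigma_additive unit_circle \<mu> \<and> (\<forall>A\<in>sets unit_circle. positive_semidefinite (\<mu> A))"

abbreviation entry_integral ::
    "(complex set \<Rightarrow> complex^'l^'l) \<Rightarrow> 'l \<Rightarrow> 'l \<Rightarrow> (complex \<Rightarrow> complex) \<Rightarrow> complex" where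
  "entry_integral \<mu> j k h \<equiv> complex_integral unit_circle (\<lambda>A. \<mu> A $ j $ k) h"

lemma positive_semidefinite_entry_bound:
  fixes A :: "complex^'n^'n"
  assumes "positive_semidefinite A"
  shows "0 \<le> Re (A $ j $ j)" "cmod (A $ j $ k) \<le> Re (A $ j $ j) + Re (A $ k $ k)"
proof -
  have h: "A $ q $ p = cnj (A $ p $ q)" for p q
  proof -
    have "A $ q $ p = hermitian_adjoint A $ q $ p"
      using assms by (simp add: positive_semidefinite_def)
    then show ?thesis by (simp add: hermitian_adjoint_def)
  qed
  have q: "0 \<le> Re (cnj a * a * A $ j $ j + cnj a * b * A $ j $ k
      + cnj b * a * A $ k $ j + cnj b * b * A $ k $ k)" for a b :: complex and j k
  proof -
    define v where "v = axis j a + axis k b"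
    have 0: "0 \<le> Re (\<Sum>p\<in>UNIV. \<Sum>q\<in>UNIV. cnj (v $ p) * A $ p $ q * v $ q)"
      using assms by (simp add: positive_semidefinite_def less_eq_complex_def)
    have ax: "(\<Sum>p\<in>UNIV. axis m c $ p * w p) = c * w m"
      "(\<Sum>p\<in>UNIV. cnj (axis m c $ p) * w p) = cnj c * w m" for m :: 'n and c and w :: "'n \<Rightarrow> complex"
    proof -
      have "(\<Sum>p\<in>UNIV. axis m c $ p * w p) = (\<Sum>p\<in>UNIV. if p = m then c * w p else 0)"
        by (intro sum.cong) (auto simp: axis_def)
      then show "(\<Sum>p\<in>UNIV. axis m c $ p * w p) = c * w m" by simp
      have "(\<Sum>p\<in>UNIV. cnj (axis m c $ p) * w p) = (\<Sum>p\<in>UNIV. if p = m then cnj c * w p else 0)"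
        by (intro sum.cong) (auto simp: axis_def)
      then show "(\<Sum>p\<in>UNIV. cnj (axis m c $ p) * w p) = cnj c * w m" by simp
    qed
    have 1: "(\<Sum>q\<in>UNIV. A $ p $ q * v $ q) = A $ p $ j * a + A $ p $ k * b" for p
      using ax(1)[of j a "\<lambda>q. A $ p $ q"] ax(1)[of k b "\<lambda>q. A $ p $ q"]
      by (simp add: v_def distrib_left sum.distrib mult.commute)
    have 2: "(\<Sum>p\<in>UNIV. cnj (v $ p) * w p) = cnj a * w j + cnj b * w k" for w :: "'n \<Rightarrow> complex"
      by (simp add: v_def distrib_right sum.distrib ax(2))
    have "(\<Sum>p\<in>UNIV. \<Sum>q\<in>UNIV. cnj (v $ p) * A $ p $ q * v $ q) =
        (\<Sum>p\<in>UNIV. cnj (v $ p) * (A $ p $ j * a + A $ p $ k * b))"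
      by (simp add: mult.assoc 1 flip: sum_distrib_left)
    also have "\<dots> = cnj a * (A $ j $ j * a + A $ j $ k * b) + cnj b * (A $ k $ j * a + A $ k $ k * b)"
      by (rule 2)
    finally show ?thesis using 0 by (simp add: algebra_simps)
  qed
  show "0 \<le> Re (A $ j $ j)" using q[where a = 1 and b = 0 and j = j and k = j] by simp
  have re: "\<bar>Re (A $ j $ k)\<bar> \<le> (Re (A $ j $ j) + Re (A $ k $ k)) / 2"
    using q[where a = 1 and b = 1 and j = j and k = k]
      q[where a = 1 and b = "-1" and j = j and k = k]
      h[of j k] by simp
  have im: "\<bar>Im (A $ j $ k)\<bar> \<le> (Re (A $ j $ j) + Re (A $ k $ k)) / 2"
    using q[where a = 1 and b = \<i> and j = j and k = k]
      q[where a = 1 and b = "-\<i>" and j = j and k = k]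
      h[of j k] by simp
  show "cmod (A $ j $ k) \<le> Re (A $ j $ j) + Re (A $ k $ k)"
    using order.trans[OF cmod_le add_mono[OF re im]] by (simp only: field_sum_of_halves)
qed

text \<open>Integration against the matrix entries of \<open>\<mu>\<close> recovers \<open>\<mu>\<close>.\<close>

lemma entry_integral_indicator:
  assumes \<mu>: "matrix_measure \<mu>" and A: "A \<in> sets unit_circle"
  shows "entry_integral \<mu> j k (indicator A) = \<mu> A $ j $ k"
proof (rule complex_integral_indicator[OF _ _ A])
  have sa: "sigma_additive unit_circle \<mu>" and psd: "\<And>B. B \<in> sets unit_circle \<Longrightarrow> positive_semidefinite (\<mu> B)"
    using \<mu> by (auto simp: matrix_measure_def)
  show "sigma_additive unit_circle (\<lambda>A. \<mu> A $ j $ k)"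
    unfolding sigma_additive_def
  proof (intro allI impI)
    fix F :: "nat \<Rightarrow> complex set"
    assume "range F \<subseteq> sets unit_circle" "disjoint_family F"
    then have "(\<lambda>i. \<mu> (F i)) sums \<mu> (\<Union>i. F i)"
      using sa unfolding sigma_additive_def by simp
    from bounded_linear.sums[OF bounded_linear_vec_nth this, of j]
    have "(\<lambda>i. \<mu> (F i) $ j) sums (\<mu> (\<Union>i. F i) $ j)" .
    from bounded_linear.sums[OF bounded_linear_vec_nth this, of k]
    show "(\<lambda>i. \<mu> (F i) $ j $ k) sums (\<mu> (\<Union>i. F i) $ j $ k)" .
  qed
  let ?S = "sphere 0 1 :: complex set"
  fix B assume B: "B \<in> sets unit_circle"
  have S: "?S \<in> sets unit_circle"
    using sets.top[of unit_circle] by (simp add: space_restrict_space)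
  have BS: "B \<subseteq> ?S"
    using sets.sets_into_space[OF B] by (simp add: space_restrict_space)
  have "\<mu> (B \<union> (?S - B)) = \<mu> B + \<mu> (?S - B)"
    using B S by (intro sigma_additive_Un[OF sa]) auto
  then have eq: "\<mu> ?S = \<mu> B + \<mu> (?S - B)"
    using BS by (simp add: Un_absorb1)
  have "Re (\<mu> B $ p $ p) \<le> Re (\<mu> ?S $ p $ p)" for p
    using positive_semidefinite_entry_bound(1)[OF psd, of "?S - B" p] B S eq by auto
  then show "cmod (\<mu> B $ j $ k) \<le> Re (\<mu> ?S $ j $ j) + Re (\<mu> ?S $ k $ k)"
    using order.trans[OF positive_semidefinite_entry_bound(2)[OF psd[OF B]] add_mono] by blast
qed


section \<open>Matrix and vector polynomials\<close>

text \<open>A matrix polynomial is a matrix of scalar polynomials, and a \<open>\<complex>\<^sup>l\<close>-valued polynomial is a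
  vector of scalar polynomials.\<close>

definition matrix_poly :: "complex poly^'l^'l \<Rightarrow> complex \<Rightarrow> complex^'l^'l" where
  "matrix_poly F z = map_matrix (\<lambda>p. poly p z) F"

definition matrix_inner ::
    "(complex set \<Rightarrow> complex^'l^'l) \<Rightarrow> complex poly^'l^'l \<Rightarrow> complex poly^'l^'l \<Rightarrow> complex^'l^'l" where
  "matrix_inner \<mu> F G = (\<chi> a b. \<Sum>j\<in>UNIV. \<Sum>k\<in>UNIV.
     entry_integral \<mu> j k (\<lambda>z. hermitian_adjoint (matrix_poly F z) $ a $ j * matrix_poly G z $ k $ b))"

definition vector_inner ::
    "(complex set \<Rightarrow> complex^'l^'l) \<Rightarrow> complex poly^'l \<Rightarrow> complex poly^'l \<Rightarrow> complex" where
  "vector_inner \<mu> f g = (\<Sum>j\<in>UNIV. \<Sum>k\<in>UNIV.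
     entry_integral \<mu> j k (\<lambda>z. cnj (poly (f $ j) z) * poly (g $ k) z))"

definition nontrivial_measure :: "(complex set \<Rightarrow> complex^'l^'l) \<Rightarrow> bool" where
  "nontrivial_measure \<mu> \<longleftrightarrow> (\<forall>F. F \<noteq> 0 \<longrightarrow> 0 < trace (matrix_inner \<mu> F F))"

definition monic_of_degree :: "nat \<Rightarrow> complex poly^'l^'l \<Rightarrow> bool" where
  "monic_of_degree n F \<longleftrightarrow>
     map_matrix (\<lambda>p. coeff p n) F = mat 1 \<and> (\<forall>i j. degree (F $ i $ j) \<le> n)"

definition Phi_R :: "(complex set \<Rightarrow> complex^'l^'l) \<Rightarrow> nat \<Rightarrow> complex poly^'l^'l" where
  "Phi_R \<mu> n = (THE F. monic_of_degree n F \<and> (\<forall>k<n. matrix_inner \<mu> (mat (monom 1 k)) F = 0))"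

definition vscale :: "complex \<Rightarrow> complex poly^'l \<Rightarrow> complex poly^'l" where
  "vscale c f = (\<chi> i. smult c (f $ i))"

definition Vpoly :: "nat \<Rightarrow> (complex poly^'l) set" where
  "Vpoly n = {f. \<forall>i. degree (f $ i) \<le> n}"

definition ortho_proj ::
    "(complex set \<Rightarrow> complex^'l^'l) \<Rightarrow> nat \<Rightarrow> complex poly^'l \<Rightarrow> complex poly^'l" where
  "ortho_proj \<mu> n f = (THE p. p \<in> Vpoly n \<and> (\<forall>q\<in>Vpoly n. vector_inner \<mu> q (f - p) = 0))"

definition mult_z :: "complex poly^'l \<Rightarrow> complex poly^'l" where
  "mult_z f = [:0, 1:] *s f"


section \<open>Determinant of an operator on a finite-dimensional subspace\<close>

context vector_space
begin

definition ordered_basis :: "'b list \<Rightarrow> 'b set \<Rightarrow> bool" where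
  "ordered_basis bs V \<longleftrightarrow> distinct bs \<and> independent (set bs) \<and> span (set bs) = V"

definition operator_matrix :: "'b list \<Rightarrow> ('b \<Rightarrow> 'b) \<Rightarrow> 'a mat" where
  "operator_matrix bs T = Matrix.mat (length bs) (length bs)
     (\<lambda>(i, j). representation (set bs) (T (bs ! j)) (bs ! i))"

definition det_on :: "'b set \<Rightarrow> ('b \<Rightarrow> 'b) \<Rightarrow> 'a" where
  "det_on V T = Determinant.det (local.operator_matrix (SOME bs. local.ordered_basis bs V) T)"

text \<open>The determinant does not depend on the chosen basis.\<close>

lemma det_on_eq:
  assumes bs: "local.ordered_basis bs V" and T: "Vector_Spaces.linear scale scale T" "T ` V \<subseteq> V"
  shows "local.det_on V T = Determinant.det (local.operator_matrix bs T)"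
proof -
  define cs where "cs = (SOME cs. local.ordered_basis cs V)"
  have cs: "local.ordered_basis cs V"
    unfolding cs_def by (rule someI[where P = "\<lambda>cs. local.ordered_basis cs V", OF bs])
  interpret T: Vector_Spaces.linear scale scale T by fact
  note def = local.ordered_basis_def
  define N where "N = length bs"
  have "card (set bs) = card (set cs)"
    using bs cs by (metis def dim_span_eq_card_independent)
  then have len: "length cs = N"
    using bs cs by (simp add: def distinct_card N_def)
  define P where "P xs ys =
    Matrix.mat N N (\<lambda>(i, j). representation (set xs) (ys ! j) (xs ! i))" for xs ys :: "'b list"
  have expand: "representation (set ys) (S v) b =
      (\<Sum>k<N. representation (set xs) v (xs ! k) * representation (set ys) (S (xs ! k)) b)"
    if xs: "local.ordered_basis xs V" "length xs = N" and ys: "local.ordered_basis ys V"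
      and S: "Vector_Spaces.linear scale scale S" "S ` V \<subseteq> V" and v: "v \<in> V" for xs ys S v b
  proof -
    interpret S: Vector_Spaces.linear scale scale S by fact
    have ix: "independent (set xs)" "span (set xs) = V" "distinct xs"
      and iy: "independent (set ys)" "span (set ys) = V" using xs ys by (auto simp: def)
    have mem: "xs ! k \<in> V" if "k < N" for k
      using ix(2) xs(2) that by (metis nth_mem span_base)
    have bij: "bij_betw ((!) xs) {..<N} (set xs)"
      using ix(3) xs(2) by (intro bij_betw_nth) auto
    have "v = (\<Sum>x\<in>set xs. scale (representation (set xs) v x) x)"
      using ix v by (intro sum_representation_eq[symmetric]) auto
    also have "\<dots> = (\<Sum>k<N. scale (representation (set xs) v (xs ! k)) (xs ! k))"
      using bij by (rule sum.reindex_bij_betw[symmetric])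
    finally have "S v = (\<Sum>k<N. scale (representation (set xs) v (xs ! k)) (S (xs ! k)))"
      by (metis (no_types, lifting) S.scale S.sum sum.cong)
    then have "representation (set ys) (S v) b =
        representation (set ys) (\<Sum>k<N. scale (representation (set xs) v (xs ! k)) (S (xs ! k))) b"
      by simp
    also have "\<dots> = (\<Sum>k<N. representation (set xs) v (xs ! k) * representation (set ys) (S (xs ! k)) b)"
    proof -
      have SV: "S (xs ! k) \<in> span (set ys)" if "k < N" for k
        using mem[OF that] S(2) iy(2) by auto
      then show ?thesis
        by (subst representation_sum[OF iy(1)])
           (auto intro!: span_scale sum.cong simp: representation_scale[OF iy(1)])
    qed
    finally show ?thesis .
  qed
  have nthV: "xs ! j \<in> V" if "local.ordered_basis xs V" "length xs = N" "j < N" for xs j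
    using that by (metis def nth_mem span_base)
  have lid: "Vector_Spaces.linear scale scale (\<lambda>x. x)" by (rule local.linear_ident)
  have inv: "P xs ys * P ys xs = 1\<^sub>m N"
    if xs: "local.ordered_basis xs V" "length xs = N" and ys: "local.ordered_basis ys V" "length ys = N" for xs ys
  proof (rule eq_matI)
    fix i j assume ij: "i < dim_row (1\<^sub>m N :: 'a mat)" "j < dim_col (1\<^sub>m N :: 'a mat)"
    have "(P xs ys * P ys xs) $$ (i, j) =
        (\<Sum>k<N. representation (set ys) (xs ! j) (ys ! k) * representation (set xs) (ys ! k) (xs ! i))"
      using ij by (simp add: P_def scalar_prod_def atLeast0LessThan mult.commute)
    also have "\<dots> = representation (set xs) (xs ! j) (xs ! i)"
      using expand[OF ys xs(1) lid, of "xs ! j" "xs ! i"] nthV[OF xs, of j] ij by simp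
    also have "\<dots> = (if xs ! i = xs ! j then 1 else 0)"
      using xs ij by (subst representation_basis) (auto simp: def)
    also have "\<dots> = 1\<^sub>m N $$ (i, j)"
      using xs ij by (simp add: def nth_eq_iff_index_eq)
    finally show "(P xs ys * P ys xs) $$ (i, j) = 1\<^sub>m N $$ (i, j)" .
  qed (auto simp: P_def)
  have sim: "local.operator_matrix cs T = P cs bs * local.operator_matrix bs T * P bs cs"
  proof (rule eq_matI)
    let ?Q = "P cs bs * local.operator_matrix bs T * P bs cs"
    fix i j assume "i < dim_row ?Q" "j < dim_col ?Q"
    then have ij: "i < N" "j < N" by (auto simp: P_def)
    have "?Q $$ (i, j) = (\<Sum>m<N. (\<Sum>k<N. representation (set cs) (bs ! k) (cs ! i) *
        representation (set bs) (T (bs ! m)) (bs ! k)) * representation (set bs) (cs ! j) (bs ! m))"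
      using ij by (simp add: P_def scalar_prod_def atLeast0LessThan local.operator_matrix_def N_def[symmetric])
    also have "\<dots> = (\<Sum>m<N. representation (set bs) (cs ! j) (bs ! m) *
        representation (set cs) (T (bs ! m)) (cs ! i))"
    proof (rule sum.cong[OF refl])
      fix m assume m: "m \<in> {..<N}"
      then have "T (bs ! m) \<in> V" using nthV[OF bs] T(2) by (auto simp: N_def)
      from expand[OF bs _ cs lid _ this, of "cs ! i"]
      show "(\<Sum>k<N. representation (set cs) (bs ! k) (cs ! i) *
          representation (set bs) (T (bs ! m)) (bs ! k)) * representation (set bs) (cs ! j) (bs ! m)
        = representation (set bs) (cs ! j) (bs ! m) * representation (set cs) (T (bs ! m)) (cs ! i)"
        by (simp add: N_def mult.commute)
    qed
    also have "\<dots> = representation (set cs) (T (cs ! j)) (cs ! i)"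
      using expand[OF bs _ cs T nthV[OF cs len ij(2)], of "cs ! i"] by (simp add: N_def)
    also have "\<dots> = local.operator_matrix cs T $$ (i, j)"
      using ij len by (simp add: local.operator_matrix_def)
    finally show "local.operator_matrix cs T $$ (i, j) = ?Q $$ (i, j)" ..
  qed (auto simp: P_def local.operator_matrix_def len)
  have "similar_mat (local.operator_matrix cs T) (local.operator_matrix bs T)"
    unfolding similar_mat_def similar_mat_wit_def Let_def
    using sim inv[OF cs len bs] inv[OF bs _ cs len]
    by (intro exI[of _ "P cs bs"] exI[of _ "P bs cs"])
       (auto simp: P_def local.operator_matrix_def len N_def)
  then show ?thesis
    unfolding local.det_on_def cs_def[symmetric] by (rule det_similar)
qed

end

interpretation vpoly: vector_space "vscale :: complex \<Rightarrow> complex poly^'l \<Rightarrow> _"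
  by unfold_locales (simp_all add: vscale_def vec_eq_iff smult_add_right smult_add_left)

end

theory Submission
  imports Defs
begin

text \<open>Write \<open>T = \<pi> M\<^sub>z \<pi>\<close> on \<open>\<V>\<close>, the vector polynomials of degree less than \<open>n\<close>. Non-triviality makes the
  sesquilinear form on vector polynomials definite, so orthogonal projections onto the
  finite-dimensional space \<open>\<V>\<close> exist and are unique (\<open>ex_ortho_proj_span\<close>, \<open>ortho_proj_eqI\<close>). The columns
  of \<open>\<Phi>\<^sub>n\<close> have leading terms \<open>z\<^sup>n e\<^sub>b\<close> and are orthogonal to \<open>\<V>\<close>, hence
  \<open>\<Phi>\<^sub>n e\<^sub>b = z\<^sup>n e\<^sub>b - \<pi> (z\<^sup>n e\<^sub>b)\<close> (\<open>Phi_R_column\<close>).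

  Multiplication by \<open>z\<close> leaves \<open>\<V>\<close> only at the top degree, where the projection of \<open>z\<^sup>n e\<^sub>b\<close> is
  \<open>z\<^sup>n e\<^sub>b - \<Phi>\<^sub>n e\<^sub>b\<close>. In the basis of monomials \<open>z\<^sup>k e\<^sub>a\<close> the operator \<open>T\<close> is thus the block companion
  matrix of the monic matrix polynomial \<open>\<Phi>\<^sub>n\<close> (\<open>det_compressed_shift\<close>), and as for scalar polynomials
  the determinant of \<open>z\<close> minus the companion matrix is the determinant of the polynomial at \<open>z\<close>
  (\<open>det_block_companion\<close>).\<close>

section \<open>The sesquilinear form on vector polynomials\<close>

text \<open>If the set function handed to \<open>measure_of\<close> is not a measure, the result is the zero measure;
  otherwise the total mass is a value of \<open>ennreal (pos_variation M \<nu> _)\<close>, which is never \<open>\<infinity>\<close>.\<close>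

lemma finite_measure_pos_part: "finite_measure (pos_part M \<nu>)"
proof
  show "emeasure (pos_part M \<nu>) (space (pos_part M \<nu>)) \<noteq> \<infinity>"
    unfolding pos_part_def by (simp add: emeasure_measure_of_conv)
qed

text \<open>The circle is compact, so a continuous function on it is bounded, and bounded measurable functions
  are integrable against a finite measure.\<close>

lemma integrable_pos_part_unit_circle:
  assumes "continuous_on (sphere 0 1) h"
  shows "integrable (pos_part unit_circle \<nu>) (h :: complex \<Rightarrow> complex)"
proof -
  interpret finite_measure "pos_part unit_circle \<nu>" by (rule finite_measure_pos_part)
  have "bounded (h ` sphere 0 1)"
    using assms by (intro compact_imp_bounded compact_continuous_image) auto
  then obtain C where C: "\<And>z. z \<in> sphere 0 1 \<Longrightarrow> norm (h z) \<le> C"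
    unfolding bounded_iff by blast
  have sp: "space (pos_part unit_circle \<nu>) = sphere 0 1"
    by (simp add: pos_part_def space_measure_of_conv space_restrict_space)
  have st: "sets (pos_part unit_circle \<nu>) = sets unit_circle"
    unfolding pos_part_def by (rule sets.sets_measure_of_eq)
  show ?thesis
  proof (rule integrable_const_bound)
    show "AE z in pos_part unit_circle \<nu>. norm (h z) \<le> C"
      using C sp by (intro AE_I2) simp
    have "h \<in> borel_measurable unit_circle"
      using assms by (rule borel_measurable_continuous_on_restrict)
    then show "h \<in> borel_measurable (pos_part unit_circle \<nu>)"
      using measurable_cong_sets[OF st refl] by blast
  qed
qed

lemma complex_integral_add:
  assumes "continuous_on (sphere 0 1) g" "continuous_on (sphere 0 1) h"
  shows "complex_integral unit_circle \<nu> (\<lambda>z. g z + h z) =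
    complex_integral unit_circle \<nu> g + complex_integral unit_circle \<nu> h"
  using assms by (simp add: complex_integral_def signed_integral_def integrable_pos_part_unit_circle
      algebra_simps)

lemma complex_integral_cmult:
  "complex_integral M \<nu> (\<lambda>z. c * h z) = c * complex_integral M \<nu> h"
  by (simp add: complex_integral_def signed_integral_def algebra_simps)

lemma vector_inner_add:
  "vector_inner \<mu> (f + f') g = vector_inner \<mu> f g + vector_inner \<mu> f' g"
  "vector_inner \<mu> f (g + g') = vector_inner \<mu> f g + vector_inner \<mu> f g'"
proof -
  have c: "continuous_on (sphere 0 1) (\<lambda>z. cnj (poly (p $ j) z) * poly (q $ k) z)"
    for p q :: "complex poly^'l" and j k
    by (intro continuous_intros)
  show "vector_inner \<mu> (f + f') g = vector_inner \<mu> f g + vector_inner \<mu> f' g"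
    "vector_inner \<mu> f (g + g') = vector_inner \<mu> f g + vector_inner \<mu> f g'"
    by (simp_all add: vector_inner_def distrib_left distrib_right complex_integral_add[OF c c]
        sum.distrib)
qed

lemma vector_inner_scale:
  "vector_inner \<mu> (vscale c f) g = cnj c * vector_inner \<mu> f g"
  "vector_inner \<mu> f (vscale c g) = c * vector_inner \<mu> f g"
proof -
  have "entry_integral \<mu> j k (\<lambda>z. cnj c * cnj (poly (f $ j) z) * poly (g $ k) z)
      = cnj c * entry_integral \<mu> j k (\<lambda>z. cnj (poly (f $ j) z) * poly (g $ k) z)" for j k
    unfolding mult.assoc by (rule complex_integral_cmult)
  then show "vector_inner \<mu> (vscale c f) g = cnj c * vector_inner \<mu> f g"
    by (simp add: vector_inner_def vscale_def sum_distrib_left)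
  have "entry_integral \<mu> j k (\<lambda>z. cnj (poly (f $ j) z) * (c * poly (g $ k) z))
      = c * entry_integral \<mu> j k (\<lambda>z. cnj (poly (f $ j) z) * poly (g $ k) z)" for j k
    unfolding mult.left_commute[of _ c] by (rule complex_integral_cmult)
  then show "vector_inner \<mu> f (vscale c g) = c * vector_inner \<mu> f g"
    by (simp add: vector_inner_def vscale_def sum_distrib_left)
qed

lemma vector_inner_zero_right [simp]: "vector_inner \<mu> f 0 = 0"
  using vector_inner_add(2)[of \<mu> f 0 0] by simp

lemma vector_inner_diff_right: "vector_inner \<mu> f (g - g') = vector_inner \<mu> f g - vector_inner \<mu> f g'"
  using vector_inner_add(2)[of \<mu> f "g - g'" g'] by simp

text \<open>This reduces orthogonality of matrix polynomials to that of their columns: \<open>F\<close> is orthogonal to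
  \<open>z\<^sup>k\<close> times the identity exactly when each column of \<open>F\<close> is orthogonal to all \<open>z\<^sup>k e\<^sub>a\<close>.\<close>

lemma matrix_inner_columns:
  "matrix_inner \<mu> F G $ a $ b = vector_inner \<mu> (\<chi> j. F $ j $ a) (\<chi> j. G $ j $ b)"
  by (simp add: matrix_inner_def vector_inner_def hermitian_adjoint_def matrix_poly_def map_matrix_def)

text \<open>Non-triviality speaks of matrix polynomials; it is applied to the one whose only non-zero column
  is \<open>f\<close>.\<close>

lemma vector_inner_definite:
  fixes f :: "complex poly^'l"
  assumes "nontrivial_measure \<mu>" "vector_inner \<mu> f f = 0"
  shows "f = 0"
proof (rule ccontr)
  assume f: "f \<noteq> 0"
  obtain b :: 'l where True by simp
  define F :: "complex poly^'l^'l" where "F = (\<chi> i j. if j = b then f $ i else 0)"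
  have col: "(\<chi> i. F $ i $ j) = (if j = b then f else 0)" for j
    by (simp add: F_def vec_eq_iff)
  have "F \<noteq> 0"
    using f by (auto simp: F_def vec_eq_iff)
  then have "0 < trace (matrix_inner \<mu> F F)"
    using assms(1) by (simp add: nontrivial_measure_def)
  also have "trace (matrix_inner \<mu> F F) = (\<Sum>j\<in>UNIV. if j = b then vector_inner \<mu> f f else 0)"
    unfolding trace_def matrix_inner_columns col by (intro sum.cong) auto
  finally show False
    using assms(2) by simp
qed

lemma subspace_left_orthogonal: "vpoly.subspace {q. vector_inner \<mu> q f = 0}"
proof -
  have "vector_inner \<mu> 0 f = 0"
    using vector_inner_add(1)[of \<mu> 0 0 f] by simp
  then show ?thesis
    by (simp add: vpoly.subspace_def vector_inner_add vector_inner_scale)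
qed


section \<open>Monomial basis of the polynomials of bounded degree\<close>

text \<open>Dual functionals give the basis property and the coordinates at once: applying \<open>\<phi> i\<close> to a linear
  combination of \<open>bs\<close> extracts the \<open>i\<close>-th coefficient.\<close>

lemma (in vector_space) dual_functionals_representation:
  assumes lin: "\<And>i. i < length bs \<Longrightarrow> Vector_Spaces.linear scale (*) (\<phi> i)"
    and dual: "\<And>i j. i < length bs \<Longrightarrow> j < length bs \<Longrightarrow> \<phi> i (bs ! j) = (if i = j then 1 else 0)"
  shows "distinct bs" "independent (set bs)"
    "v \<in> span (set bs) \<Longrightarrow> i < length bs \<Longrightarrow> representation (set bs) v (bs ! i) = \<phi> i v"
proof -
  show dist: "distinct bs"
    unfolding distinct_conv_nth using dual by (metis zero_neq_one)
  have expand: "\<phi> i (\<Sum>x\<in>set bs. scale (f x) x) = f (bs ! i)" if i: "i < length bs" for f i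
  proof -
    interpret L: Vector_Spaces.linear scale "(*)" "\<phi> i" by (rule lin[OF i])
    have "\<phi> i x = (if x = bs ! i then 1 else 0)" if x: "x \<in> set bs" for x
    proof -
      obtain j where "j < length bs" "x = bs ! j" using x by (auto simp: in_set_conv_nth)
      then show ?thesis using dual i dist by (auto simp: nth_eq_iff_index_eq)
    qed
    then have "\<phi> i (\<Sum>x\<in>set bs. scale (f x) x) = (\<Sum>x\<in>set bs. if x = bs ! i then f x else 0)"
      unfolding L.sum L.scale by (intro sum.cong) auto
    then show ?thesis using i by simp
  qed
  show indep: "independent (set bs)"
  proof (rule independent_if_scalars_zero)
    fix f x assume 0: "(\<Sum>x\<in>set bs. scale (f x) x) = 0" and "x \<in> set bs"
    then obtain i where i: "i < length bs" "x = bs ! i" by (auto simp: in_set_conv_nth)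
    interpret L: Vector_Spaces.linear scale "(*)" "\<phi> i" by (rule lin[OF i(1)])
    show "f x = 0" using expand[OF i(1), of f] unfolding 0 i(2) by (simp add: L.zero)
  qed simp
  show "representation (set bs) v (bs ! i) = \<phi> i v" if "v \<in> span (set bs)" "i < length bs"
    using expand[OF that(2), of "representation (set bs) v"]
      sum_representation_eq[OF indep that(1)] by simp
qed

text \<open>The basis vectors \<open>z\<^sup>k e\<^sub>a\<close> are numbered by the single index \<open>m = k l + a\<close>, where \<open>a < l\<close> stands
  for the index \<open>\<epsilon> a\<close>. All \<open>m\<close> are admitted, beyond the dimension too, so that multiplication by \<open>z\<close>
  is the shift \<open>m \<mapsto> m + l\<close> with no exception at the top degree.\<close>

definition monomial_basis :: "(nat \<Rightarrow> 'l) \<Rightarrow> nat \<Rightarrow> complex poly^'l" where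
  "monomial_basis \<epsilon> m = axis (\<epsilon> (m mod CARD('l))) (monom 1 (m div CARD('l)))"

text \<open>The coefficient of \<open>z\<^sup>k e\<^sub>a\<close>, for \<open>m = k l + a\<close>.\<close>

definition coordinate :: "(nat \<Rightarrow> 'l) \<Rightarrow> nat \<Rightarrow> complex poly^'l \<Rightarrow> complex" where
  "coordinate \<epsilon> m f = coeff (f $ \<epsilon> (m mod CARD('l))) (m div CARD('l))"

lemma coordinate_linear: "Vector_Spaces.linear vscale (*) (coordinate \<epsilon> m)"
  by unfold_locales (simp_all add: coordinate_def vscale_def algebra_simps)

lemma coordinate_monomial_basis:
  fixes \<epsilon> :: "nat \<Rightarrow> 'l::finite"
  assumes "inj_on \<epsilon> {0..<CARD('l)}"
  shows "coordinate \<epsilon> i (monomial_basis \<epsilon> j) = (if i = j then 1 else 0)"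
proof -
  have "\<epsilon> (i mod CARD('l)) = \<epsilon> (j mod CARD('l)) \<longleftrightarrow> i mod CARD('l) = j mod CARD('l)"
    using assms by (auto dest!: inj_onD)
  moreover have "i = j \<longleftrightarrow> i mod CARD('l) = j mod CARD('l) \<and> i div CARD('l) = j div CARD('l)"
    by (metis div_mult_mod_eq)
  ultimately show ?thesis
    by (auto simp: coordinate_def monomial_basis_def axis_def coeff_monom)
qed

lemma monomial_basis_add_card:
  "monomial_basis \<epsilon> (m + CARD('l)) = mult_z (monomial_basis \<epsilon> m :: complex poly^'l)"
  by (simp add: monomial_basis_def mult_z_def vec_eq_iff axis_def monom_Suc)

lemma subspace_Vpoly: "vpoly.subspace (Vpoly n)"
  by (auto simp: vpoly.subspace_def Vpoly_def vscale_def
      intro: degree_add_le order.trans[OF degree_smult_le])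

lemma monomial_basis_in_Vpoly:
  "m < Suc n * CARD('l) \<Longrightarrow> (monomial_basis \<epsilon> m :: complex poly^'l) \<in> Vpoly n"
  using less_mult_imp_div_less[of m "Suc n" "CARD('l)"]
  by (auto simp: monomial_basis_def Vpoly_def axis_def intro: order.trans[OF degree_monom_le])

text \<open>Both sides have the same coordinates at every index \<open>i\<close>; for \<open>i\<close> beyond the dimension the bound
  on the degree makes the coordinate of \<open>f\<close> vanish.\<close>

lemma monomial_expansion:
  fixes \<epsilon> :: "nat \<Rightarrow> 'l::finite"
  assumes \<epsilon>: "bij_betw \<epsilon> {0..<CARD('l)} UNIV" and f: "f \<in> Vpoly n"
  shows "f = (\<Sum>m<Suc n * CARD('l). vscale (coordinate \<epsilon> m f) (monomial_basis \<epsilon> m))"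
    (is "f = ?g")
proof -
  have inj: "inj_on \<epsilon> {0..<CARD('l)}" using \<epsilon> by (rule bij_betw_imp_inj_on)
  have coord: "coordinate \<epsilon> i ?g = coordinate \<epsilon> i f" for i
  proof -
    interpret L: Vector_Spaces.linear vscale "(*)" "coordinate \<epsilon> i" by (rule coordinate_linear)
    have "coordinate \<epsilon> i ?g = (\<Sum>m<Suc n * CARD('l). if i = m then coordinate \<epsilon> m f else 0)"
      unfolding L.sum L.scale coordinate_monomial_basis[OF inj] by (intro sum.cong) auto
    also have "\<dots> = coordinate \<epsilon> i f"
    proof (cases "i < Suc n * CARD('l)")
      case False
      then have "n < i div CARD('l)"
        by (simp add: less_eq_div_iff_mult_less_eq Suc_le_eq[symmetric])
      then have "degree (f $ \<epsilon> (i mod CARD('l))) < i div CARD('l)"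
        using f le_less_trans unfolding Vpoly_def by blast
      then have "coordinate \<epsilon> i f = 0"
        unfolding coordinate_def by (rule coeff_eq_0)
      then show ?thesis using False by auto
    qed simp
    finally show ?thesis .
  qed
  have "coeff (f $ a) k = coeff (?g $ a) k" for a k
  proof -
    obtain b where b: "b < CARD('l)" "\<epsilon> b = a"
      using \<epsilon> unfolding bij_betw_def by (metis UNIV_I atLeastLessThan_iff imageE)
    then show ?thesis using coord[of "k * CARD('l) + b"] by (simp add: coordinate_def)
  qed
  then show ?thesis by (simp add: vec_eq_iff poly_eq_iff)
qed

lemma span_monomial_basis:
  fixes \<epsilon> :: "nat \<Rightarrow> 'l::finite"
  assumes \<epsilon>: "bij_betw \<epsilon> {0..<CARD('l)} UNIV"
  shows "vpoly.span (monomial_basis \<epsilon> ` {..<Suc n * CARD('l)}) = Vpoly n"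
proof (intro equalityI subsetI)
  show "f \<in> Vpoly n" if "f \<in> vpoly.span (monomial_basis \<epsilon> ` {..<Suc n * CARD('l)})" for f
    using vpoly.span_minimal[OF _ subspace_Vpoly, of "monomial_basis \<epsilon> ` {..<Suc n * CARD('l)}" n]
      monomial_basis_in_Vpoly that by blast
  show "f \<in> vpoly.span (monomial_basis \<epsilon> ` {..<Suc n * CARD('l)})" if "f \<in> Vpoly n" for f
    by (subst monomial_expansion[OF \<epsilon> that])
      (intro vpoly.span_sum vpoly.span_scale vpoly.span_base imageI)
qed

lemma ex_enumeration: "\<exists>\<epsilon> :: nat \<Rightarrow> 'l::finite. bij_betw \<epsilon> {0..<CARD('l)} UNIV"
  using ex_bij_betw_nat_finite[of "UNIV :: 'l set"] by simp

section \<open>Orthogonal projection and the orthogonal polynomials\<close>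

text \<open>One Gram--Schmidt step per element of \<open>S\<close>: the new vector \<open>b\<close> is replaced by its component \<open>b'\<close>
  orthogonal to the old span, and the projection gains the multiple of \<open>b'\<close> that makes the
  remainder orthogonal to \<open>b'\<close>. If \<open>b' = 0\<close>, the multiple is irrelevant.\<close>

lemma ex_ortho_proj_span:
  assumes nt: "nontrivial_measure \<mu>" and "finite S"
  shows "\<exists>p\<in>vpoly.span S. \<forall>q\<in>vpoly.span S. vector_inner \<mu> q (f - p) = 0"
  using \<open>finite S\<close>
proof (induction S arbitrary: f rule: finite_induct)
  case empty
  have "vector_inner \<mu> 0 f = 0" for f
    using vpoly.subspace_0[OF subspace_left_orthogonal] by auto
  then show ?case by simp
next
  case (insert b S)
  obtain pf where pf: "pf \<in> vpoly.span S" "\<And>q. q \<in> vpoly.span S \<Longrightarrow> vector_inner \<mu> q (f - pf) = 0"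
    using insert.IH by blast
  obtain pb where pb: "pb \<in> vpoly.span S" "\<And>q. q \<in> vpoly.span S \<Longrightarrow> vector_inner \<mu> q (b - pb) = 0"
    using insert.IH by blast
  define b' where "b' = b - pb"
  define c where "c = vector_inner \<mu> b' (f - pf) / vector_inner \<mu> b' b'"
  have sub: "vpoly.span S \<subseteq> vpoly.span (insert b S)"
    by (intro vpoly.span_mono) auto
  have b'_in: "b' \<in> vpoly.span (insert b S)"
    unfolding b'_def using subsetD[OF sub pb(1)] by (simp add: vpoly.span_base vpoly.span_diff)
  have b': "vector_inner \<mu> b' (f - pf - vscale c b') = 0"
  proof (cases "vector_inner \<mu> b' b' = 0")
    case True
    then have "b' = 0" using vector_inner_definite[OF nt] by blast
    then show ?thesis using vpoly.subspace_0[OF subspace_left_orthogonal] by auto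
  qed (simp add: vector_inner_diff_right vector_inner_scale c_def)
  have S: "vector_inner \<mu> q (f - pf - vscale c b') = 0" if "q \<in> vpoly.span S" for q
    using pf(2)[OF that] pb(2)[OF that]
    by (simp add: vector_inner_diff_right[of _ _ "f - pf"] vector_inner_scale b'_def)
  show ?case
  proof (intro bexI[of _ "pf + vscale c b'"] ballI)
    show "pf + vscale c b' \<in> vpoly.span (insert b S)"
      using pf(1) sub b'_in by (intro vpoly.span_add vpoly.span_scale) auto
    fix q assume "q \<in> vpoly.span (insert b S)"
    then obtain k where k: "q - vscale k b \<in> vpoly.span S"
      using vpoly.span_breakdown_eq by blast
    have "q - vscale k b + vscale k pb \<in> vpoly.span S"
      using k pb(1) by (intro vpoly.span_add vpoly.span_scale)
    moreover have "q = (q - vscale k b + vscale k pb) + vscale k b'"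
      by (simp add: b'_def vpoly.scale_right_diff_distrib)
    ultimately have "vector_inner \<mu> q (f - pf - vscale c b') = 0"
      using S b' vector_inner_add(1) vector_inner_scale(1) by (metis add_0 mult_zero_right)
    then show "vector_inner \<mu> q (f - (pf + vscale c b')) = 0"
      by (simp add: diff_diff_eq)
  qed
qed

lemma ortho_proj_eqI:
  assumes nt: "nontrivial_measure \<mu>" and p: "p \<in> Vpoly n"
    and orth: "\<And>q. q \<in> Vpoly n \<Longrightarrow> vector_inner \<mu> q (f - p) = 0"
  shows "ortho_proj \<mu> n f = p"
  unfolding ortho_proj_def
proof (rule the_equality)
  show "p \<in> Vpoly n \<and> (\<forall>q\<in>Vpoly n. vector_inner \<mu> q (f - p) = 0)"
    using p orth by blast
  fix p' assume p': "p' \<in> Vpoly n \<and> (\<forall>q\<in>Vpoly n. vector_inner \<mu> q (f - p') = 0)"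
  then have d: "p' - p \<in> Vpoly n"
    using p vpoly.subspace_diff[OF subspace_Vpoly] by blast
  have "vector_inner \<mu> (p' - p) ((f - p) - (f - p')) = 0"
    unfolding vector_inner_diff_right[of _ _ "f - p"] using p' orth d by simp
  then have "p' - p = 0"
    by (intro vector_inner_definite[OF nt]) simp
  then show "p' = p" by simp
qed

lemma ortho_proj:
  fixes f :: "complex poly^'l"
  assumes nt: "nontrivial_measure \<mu>"
  shows "ortho_proj \<mu> n f \<in> Vpoly n"
    "q \<in> Vpoly n \<Longrightarrow> vector_inner \<mu> q (f - ortho_proj \<mu> n f) = 0"
proof -
  obtain \<epsilon> :: "nat \<Rightarrow> 'l" where "bij_betw \<epsilon> {0..<CARD('l)} UNIV"
    using ex_enumeration by blast
  from span_monomial_basis[OF this, of n]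
  obtain p where p: "p \<in> Vpoly n" "\<And>q. q \<in> Vpoly n \<Longrightarrow> vector_inner \<mu> q (f - p) = 0"
    using ex_ortho_proj_span[OF nt, of "monomial_basis \<epsilon> ` {..<Suc n * CARD('l)}" f] by auto
  then show "ortho_proj \<mu> n f \<in> Vpoly n"
    "q \<in> Vpoly n \<Longrightarrow> vector_inner \<mu> q (f - ortho_proj \<mu> n f) = 0"
    using ortho_proj_eqI[OF nt p] by simp_all
qed

lemma ortho_proj_id:
  assumes "nontrivial_measure \<mu>" "f \<in> Vpoly n"
  shows "ortho_proj \<mu> n f = f"
  using assms by (intro ortho_proj_eqI) simp_all

lemma ortho_proj_linear:
  assumes nt: "nontrivial_measure \<mu>"
  shows "Vector_Spaces.linear vscale vscale (ortho_proj \<mu> n)"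
proof unfold_locales
  fix f g c
  have "vector_inner \<mu> q (f + g - (ortho_proj \<mu> n f + ortho_proj \<mu> n g)) = 0" if "q \<in> Vpoly n" for q
    using ortho_proj(2)[OF nt that, of f] ortho_proj(2)[OF nt that, of g]
    by (simp only: add_diff_add vector_inner_add add_0_left)
  then show "ortho_proj \<mu> n (f + g) = ortho_proj \<mu> n f + ortho_proj \<mu> n g"
    using ortho_proj(1)[OF nt] by (intro ortho_proj_eqI[OF nt] vpoly.subspace_add[OF subspace_Vpoly])
  have "vector_inner \<mu> q (vscale c f - vscale c (ortho_proj \<mu> n f)) = 0" if "q \<in> Vpoly n" for q
    using ortho_proj(2)[OF nt that, of f]
    by (simp only: vpoly.scale_right_diff_distrib[symmetric] vector_inner_scale mult_zero_right)
  then show "ortho_proj \<mu> n (vscale c f) = vscale c (ortho_proj \<mu> n f)"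
    using ortho_proj(1)[OF nt] by (intro ortho_proj_eqI[OF nt] vpoly.subspace_scale[OF subspace_Vpoly])
qed

text \<open>A matrix polynomial is monic of degree \<open>n + 1\<close> exactly when its column \<open>b\<close> is \<open>z\<^sup>n\<^sup>+\<^sup>1 e\<^sub>b\<close> minus an
  element of \<open>\<V>\<^sub>n\<close>, and orthogonality to \<open>\<V>\<^sub>n\<close> makes that element the projection of \<open>z\<^sup>n\<^sup>+\<^sup>1 e\<^sub>b\<close>. So
  existence and uniqueness of the projection give existence and uniqueness of the orthogonal
  polynomial.\<close>

lemma Phi_R_column:
  fixes \<mu> :: "complex set \<Rightarrow> complex^'l^'l"
  assumes nt: "nontrivial_measure \<mu>"
  shows "monic_of_degree (Suc n) (Phi_R \<mu> (Suc n))"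
    "(\<chi> i. Phi_R \<mu> (Suc n) $ i $ b) =
      axis b (monom 1 (Suc n)) - ortho_proj \<mu> n (axis b (monom 1 (Suc n)))"
proof -
  let ?P = "ortho_proj \<mu> n" and ?x = "\<lambda>b. axis b (monom 1 (Suc n)) :: complex poly^'l"
  define F :: "complex poly^'l^'l" where "F = (\<chi> i b. (?x b - ?P (?x b)) $ i)"
  have colF: "(\<chi> i. F $ i $ b) = ?x b - ?P (?x b)" for b
    by (simp add: F_def vec_eq_iff)
  have degP: "degree (?P f $ i) \<le> n" for f i
    using ortho_proj(1)[OF nt, of n f] by (simp add: Vpoly_def)
  have unit: "(\<chi> j. mat (monom 1 k) $ j $ a) = (axis a (monom 1 k) :: complex poly^'l)" for a k
    by (auto simp: vec_eq_iff mat_def axis_def)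
  have unitV: "axis a (monom 1 k) \<in> (Vpoly n :: (complex poly^'l) set)" if "k < Suc n" for a k
    using that by (auto simp: Vpoly_def axis_def intro: order.trans[OF degree_monom_le])
  have "monic_of_degree (Suc n) F"
  proof -
    have "coeff (F $ i $ b) (Suc n) = mat 1 $ i $ b" for i b
      using degP[of "?x b" i] by (simp add: F_def axis_def mat_def coeff_eq_0)
    moreover have "degree (F $ i $ b) \<le> Suc n" for i b
      using degP[of "?x b" i]
      by (auto simp: F_def axis_def intro!: degree_diff_le order.trans[OF degree_monom_le])
    ultimately show ?thesis by (simp add: monic_of_degree_def map_matrix_def vec_eq_iff)
  qed
  moreover have "matrix_inner \<mu> (mat (monom 1 k)) F = 0" if "k < Suc n" for k
    using ortho_proj(2)[OF nt unitV[OF that]]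
    by (simp add: vec_eq_iff matrix_inner_columns unit colF)
  moreover have "G = F"
    if G: "monic_of_degree (Suc n) G" "\<And>k. k < Suc n \<Longrightarrow> matrix_inner \<mu> (mat (monom 1 k)) G = 0" for G
  proof -
    \<comment> \<open>The leading terms cancel in \<open>z\<^sup>n\<^sup>+\<^sup>1 e\<^sub>b - G e\<^sub>b\<close>, so this is an element of \<open>\<V>\<^sub>n\<close>.\<close>
    have "?P (?x b) = ?x b - (\<chi> i. G $ i $ b)" for b
    proof (rule ortho_proj_eqI[OF nt])
      have "degree ((?x b - (\<chi> i. G $ i $ b)) $ i) \<le> n" for i
      proof (rule degree_le, intro allI impI)
        fix k assume "n < k"
        moreover have "coeff (G $ i $ b) (Suc n) = (if i = b then 1 else 0)" "degree (G $ i $ b) \<le> Suc n"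
          using G(1) by (auto simp: monic_of_degree_def map_matrix_def vec_eq_iff mat_def)
        ultimately show "coeff ((?x b - (\<chi> i. G $ i $ b)) $ i) k = 0"
          by (cases "k = Suc n") (auto simp: axis_def coeff_eq_0)
      qed
      then show "?x b - (\<chi> i. G $ i $ b) \<in> Vpoly n" by (simp add: Vpoly_def)
      obtain \<epsilon> :: "nat \<Rightarrow> 'l" where \<epsilon>: "bij_betw \<epsilon> {0..<CARD('l)} UNIV"
        using ex_enumeration by blast
      have "vector_inner \<mu> q (\<chi> i. G $ i $ b) = 0"
        if "q \<in> vpoly.span (monomial_basis \<epsilon> ` {..<Suc n * CARD('l)})" for q
        using that
      proof (induction rule: vpoly.span_induct)
        case base
        show ?case using subspace_left_orthogonal[of \<mu> "\<chi> i. G $ i $ b"] by simp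
      next
        case (step q)
        then obtain m where m: "m < Suc n * CARD('l)" "q = monomial_basis \<epsilon> m" by auto
        then have "m div CARD('l) < Suc n" by (simp add: less_mult_imp_div_less del: mult_Suc)
        from G(2)[OF this] have "matrix_inner \<mu> (mat (monom 1 (m div CARD('l)))) G $ a $ b = 0" for a
          by simp
        then show ?case unfolding m(2) by (simp add: matrix_inner_columns unit monomial_basis_def)
      qed
      then show "vector_inner \<mu> q (?x b - (?x b - (\<chi> i. G $ i $ b))) = 0" if "q \<in> Vpoly n" for q
        using that unfolding span_monomial_basis[OF \<epsilon>] by simp
    qed
    then show "G = F" by (simp add: F_def vec_eq_iff)
  qed
  ultimately have "Phi_R \<mu> (Suc n) = F"
    unfolding Phi_R_def by (intro the_equality) blast+
  with colF \<open>monic_of_degree (Suc n) F\<close>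
  show "monic_of_degree (Suc n) (Phi_R \<mu> (Suc n))"
    "(\<chi> i. Phi_R \<mu> (Suc n) $ i $ b) = ?x b - ?P (?x b)" by simp_all
qed

section \<open>The determinant of a block companion matrix\<close>

text \<open>The two determinants are the same Leibniz sum, over permutations of \<open>{0..<l}\<close> and of the index
  type; transport along \<open>\<epsilon>\<close> is a bijection between them that preserves signs.\<close>

lemma det_mat_eq_det_vec:
  fixes A :: "'a::comm_ring_1^'l^'l"
  assumes \<epsilon>: "bij_betw \<epsilon> {0..<l} (UNIV :: 'l set)"
  shows "Determinant.det (Matrix.mat l l (\<lambda>(i, j). A $ \<epsilon> i $ \<epsilon> j)) = Determinants.det A"
proof -
  let ?c = "map_permutation {0..<l} \<epsilon>"
  have inj: "inj_on \<epsilon> {0..<l}" using \<epsilon> by (rule bij_betw_imp_inj_on)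
  have bij: "bij_betw ?c {p. p permutes {0..<l}} {p. p permutes (UNIV :: 'l set)}"
  proof -
    have "?c = (\<lambda>\<pi> x. if x \<in> UNIV then \<epsilon> (\<pi> (inv_into {0..<l} \<epsilon> x)) else x)"
      using \<epsilon> by (auto simp: map_permutation_def restrict_id_def bij_betw_def fun_eq_iff)
    then show ?thesis using bij_betw_permutations[OF \<epsilon>] by simp
  qed
  have "Determinants.det A = (\<Sum>p | p permutes {0..<l}. of_int (sign (?c p)) * (\<Prod>i\<in>UNIV. A $ i $ ?c p i))"
    unfolding Determinants.det_def by (rule sum.reindex_bij_betw[OF bij, symmetric])
  also have "\<dots> = (\<Sum>p | p permutes {0..<l}. of_int (sign p) * (\<Prod>i = 0..<l. A $ \<epsilon> i $ \<epsilon> (p i)))"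
  proof (rule sum.cong[OF refl])
    fix p assume "p \<in> {p. p permutes {0..<l}}"
    then have p: "p permutes {0..<l}" by simp
    have "(\<Prod>i\<in>UNIV. A $ i $ ?c p i) = (\<Prod>i = 0..<l. A $ \<epsilon> i $ ?c p (\<epsilon> i))"
      by (rule prod.reindex_bij_betw[OF \<epsilon>, symmetric])
    also have "\<dots> = (\<Prod>i = 0..<l. A $ \<epsilon> i $ \<epsilon> (p i))"
      by (intro prod.cong) (simp_all add: map_permutation_apply[OF inj])
    finally show "of_int (sign (?c p)) * (\<Prod>i\<in>UNIV. A $ i $ ?c p i) =
        of_int (sign p) * (\<Prod>i = 0..<l. A $ \<epsilon> i $ \<epsilon> (p i))"
      by (simp add: sign_map_permutation[OF inj p])
  qed
  also have "\<dots> = Determinant.det (Matrix.mat l l (\<lambda>(i, j). A $ \<epsilon> i $ \<epsilon> j))"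
  proof -
    have "p i < l" if "p permutes {0..<l}" "i < l" for p i
      using permutes_in_image[OF that(1), of i] that(2) by simp
    then show ?thesis
      unfolding Determinant.det_def by (auto intro!: sum.cong prod.cong simp: permutes_def)
  qed
  finally show ?thesis ..
qed

text \<open>The matrix on the left is \<open>z\<close> minus the block companion matrix of
  \<open>\<Phi>(z) = z\<^sup>n\<^sup>+\<^sup>1 + \<Sum>\<^sub>r z\<^sup>r A\<^sub>r\<close>, with entry \<open>(i, j)\<close> of \<open>A\<^sub>r\<close> written \<open>A r i j\<close>. Its block rows contain the
  coefficients, with respect to \<open>1, x, \<dots>, x\<^sup>n\<close>, of \<open>(z - x) x\<^sup>k\<close> in block column \<open>k < n\<close> and of
  \<open>(z - x) x\<^sup>n + \<Phi>(x)\<close> in the last block column. Replacing the first block row by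
  \<open>\<Sum>\<^sub>k z\<^sup>k \<cdot> (row k)\<close> evaluates these polynomials at \<open>x = z\<close>: the first block row becomes
  \<open>(0, \<dots>, 0, \<Phi>(z))\<close>. Below the zeros stands an upper triangular block with diagonal \<open>-1\<close>. The sign
  of that block and the sign of moving \<open>\<Phi>(z)\<close> to the left cancel.\<close>

lemma det_block_companion:
  fixes A :: "nat \<Rightarrow> nat \<Rightarrow> nat \<Rightarrow> 'a::idom"
  assumes l: "l > 0"
  shows "Determinant.det (Matrix.mat (Suc n * l) (Suc n * l) (\<lambda>(i, j).
      (if i = j then z else 0) - (if i = j + l then 1 else 0)
      + (if n * l \<le> j then A (i div l) (i mod l) (j - n * l) else 0))) =
    Determinant.det (Matrix.mat l l (\<lambda>(i, j). (if i = j then z ^ Suc n else 0) + (\<Sum>r<Suc n. z ^ r * A r i j)))"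
    (is "Determinant.det ?M = Determinant.det ?\<Phi>")
proof -
  define m where "m = n * l"
  define N where "N = l + m"
  have N: "Suc n * l = N" by (simp add: N_def m_def)
  define M where "M = ?M"
  \<comment> \<open>The row operation that evaluates at \<open>x = z\<close>; it is unitriangular.\<close>
  define U where "U = Matrix.mat N N
    (\<lambda>(i, j). if i < l then (if j mod l = i then z ^ (j div l) else 0) else if i = j then 1 else 0)"
  have carr: "M \<in> carrier_mat N N" "U \<in> carrier_mat N N"
    by (simp_all add: M_def U_def N[symmetric] del: mult_Suc)
  have M: "M $$ (i, j) = (if i = j then z else 0) - (if i = j + l then 1 else 0)
      + (if m \<le> j then A (i div l) (i mod l) (j - m) else 0)" if "i < N" "j < N" for i j
    using that by (simp add: M_def m_def N del: mult_Suc)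
  have "upper_triangular U"
    unfolding upper_triangular_def by (auto simp: U_def)
  then have detU: "Determinant.det U = 1"
    using l by (subst det_upper_triangular[OF _ carr(2)]) (auto simp: prod_list_diag_prod U_def intro!: prod.neutral)
  \<comment> \<open>The blocks below the first block row, which the row operation does not change.\<close>
  define X where "X = Matrix.mat m m (\<lambda>(i, j). M $$ (i + l, j))"
  define Y where "Y = Matrix.mat m l (\<lambda>(i, j). M $$ (i + l, j + m))"
  have low: "(U * M) $$ (i, j) = M $$ (i, j)" if "l \<le> i" "i < N" "j < N" for i j
  proof -
    have "(U * M) $$ (i, j) = (\<Sum>k<N. U $$ (i, k) * M $$ (k, j))"
      using that carr by (simp add: scalar_prod_def atLeast0LessThan)
    also have "\<dots> = (\<Sum>k<N. if i = k then M $$ (k, j) else 0)"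
      using that by (intro sum.cong refl) (simp add: U_def)
    finally show ?thesis using that by simp
  qed
  have blocks: "(\<Sum>k<Suc n * l. if k mod l = i then f k else 0) = (\<Sum>r<Suc n. f (r * l + i))"
    if "i < l" for i and f :: "nat \<Rightarrow> 'a"
  proof -
    have "(\<Sum>r<Suc n. f (r * l + i)) = sum f ((\<lambda>r. r * l + i) ` {..<Suc n})"
      using l by (subst sum.reindex) (auto simp: inj_on_def)
    also have "(\<lambda>r. r * l + i) ` {..<Suc n} = {k\<in>{..<Suc n * l}. k mod l = i}"
    proof (intro equalityI subsetI)
      fix k assume "k \<in> (\<lambda>r. r * l + i) ` {..<Suc n}"
      then obtain r where r: "r < Suc n" "k = r * l + i" by blast
      have "r * l \<le> n * l" using r(1) by simp
      then have "r * l + i < Suc n * l" using that unfolding mult_Suc by linarith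
      then show "k \<in> {k\<in>{..<Suc n * l}. k mod l = i}" using r that by simp
    next
      fix k assume k: "k \<in> {k\<in>{..<Suc n * l}. k mod l = i}"
      then have "k div l < Suc n" by (simp add: less_mult_imp_div_less del: mult_Suc)
      moreover have "k = (k div l) * l + i" using k by auto
      ultimately show "k \<in> (\<lambda>r. r * l + i) ` {..<Suc n}" by blast
    qed
    finally show ?thesis by (simp only: sum.inter_filter[OF finite_lessThan])
  qed
  have up: "(U * M) $$ (i, j) = (\<Sum>r<Suc n. z ^ r * M $$ (r * l + i, j))" if "i < l" "j < N" for i j
  proof -
    have "(U * M) $$ (i, j) = (\<Sum>k<Suc n * l. if k mod l = i then z ^ (k div l) * M $$ (k, j) else 0)"
      unfolding N using that carr N_def
      by (simp add: scalar_prod_def atLeast0LessThan) (auto simp: U_def intro!: sum.cong)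
    also have "\<dots> = (\<Sum>r<Suc n. z ^ ((r * l + i) div l) * M $$ (r * l + i, j))"
      by (rule blocks[OF that(1)])
    finally show ?thesis using that(1) by simp
  qed
  have rl: "r * l + i < N" if "r < Suc n" "i < l" for r i
  proof -
    have "r * l \<le> n * l" using that by simp
    then show ?thesis using that unfolding N_def m_def by linarith
  qed
  have index: "(r * l + i = c * l + b) = (r = c \<and> i = b)" if "i < l" "b < l" for r i c b
  proof
    assume e: "r * l + i = c * l + b"
    have "(r * l + i) div l = (c * l + b) div l" "(r * l + i) mod l = (c * l + b) mod l"
      using e by simp_all
    then show "r = c \<and> i = b" using that by simp
  qed simp
  have UM: "U * M = four_block_mat (0\<^sub>m l m) ?\<Phi> X Y"
  proof (rule eq_matI)
    fix i j assume "i < dim_row (four_block_mat (0\<^sub>m l m) ?\<Phi> X Y)"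
      "j < dim_col (four_block_mat (0\<^sub>m l m) ?\<Phi> X Y)"
    then have ij: "i < N" "j < N" by (simp_all add: N_def X_def Y_def)
    show "(U * M) $$ (i, j) = four_block_mat (0\<^sub>m l m) ?\<Phi> X Y $$ (i, j)"
    proof (cases "i < l")
      case False
      then show ?thesis using ij low[of i j] by (auto simp: X_def Y_def N_def)
    next
      case i: True
      \<comment> \<open>Column \<open>j\<close> belongs to \<open>x\<^sup>c e\<^sub>b\<close>; below the top degree the values of \<open>z x\<^sup>c\<close> and \<open>x\<^sup>c\<^sup>+\<^sup>1\<close> at \<open>x = z\<close> cancel.\<close>
      define c b where "c = j div l" and "b = j mod l"
      have j: "j = c * l + b" "b < l" using l by (simp_all add: c_def b_def)
      have c: "c < Suc n" using ij(2) by (simp add: c_def less_mult_imp_div_less flip: N)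
      have jl: "j + l = Suc c * l + b" using j by simp
      have Mrij: "M $$ (r * l + i, j) = (if r = c \<and> i = b then z else 0) - (if r = Suc c \<and> i = b then 1 else 0)
          + (if m \<le> j then A r i (j - m) else 0)" if r: "r < Suc n" for r
        unfolding M[OF rl[OF r i] ij(2)] jl unfolding j(1) index[OF i j(2)] using i by simp
      have "(U * M) $$ (i, j) = (\<Sum>r<Suc n. (if r = c \<and> i = b then z ^ r * z else 0)
          - (if r = Suc c \<and> i = b then z ^ r else 0) + (if m \<le> j then z ^ r * A r i (j - m) else 0))"
        unfolding up[OF i ij(2)]
      proof (rule sum.cong[OF refl], goal_cases)
        case (1 r)
        then show ?case by (subst Mrij) (auto simp: distrib_left right_diff_distrib)
      qed
      also have "\<dots> = (if i = b then z ^ Suc c else 0) - (if i = b \<and> c < n then z ^ Suc c else 0)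
          + (if m \<le> j then \<Sum>r<Suc n. z ^ r * A r i (j - m) else 0)"
        using c by (simp add: sum.distrib sum_subtractf del: sum.lessThan_Suc)
      finally have e: "(U * M) $$ (i, j) = \<dots>" .
      show ?thesis
      proof (cases "m \<le> j")
        case False
        then have "c < n" unfolding c_def m_def by (simp add: less_mult_imp_div_less)
        then show ?thesis using e i False ij by (simp add: X_def)
      next
        case True
        then have "n \<le> c" unfolding c_def m_def using l by (simp add: less_eq_div_iff_mult_less_eq)
        then have "c = n" using c by simp
        then have "j - m = b" using j by (simp add: m_def)
        then show ?thesis using e i True ij \<open>c = n\<close> by (simp add: X_def Y_def N_def del: sum.lessThan_Suc)
      qed
    qed
  qed (simp_all add: X_def Y_def U_def N_def M_def m_def)
  have XY: "X \<in> carrier_mat m m" "Y \<in> carrier_mat m l" by (simp_all add: X_def Y_def)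
  have X: "X $$ (i, j) = (if i + l = j then z else 0) - (if i = j then 1 else 0)" if "i < m" "j < m" for i j
    using that by (simp add: X_def M N_def)
  have "upper_triangular X"
    unfolding upper_triangular_def using XY by (auto simp: X)
  then have detX: "Determinant.det X = (- 1) ^ m"
    using l XY by (subst det_upper_triangular[OF _ XY(1)]) (auto simp: prod_list_diag_prod X)
  have "Determinant.det M = Determinant.det (U * M)"
    by (simp add: det_mult[OF carr(2,1)] detU)
  also have "\<dots> = (- 1) ^ (l * m) * Determinant.det (four_block_mat ?\<Phi> (0\<^sub>m l m) Y X)"
    unfolding UM
    by (subst det_swap_cols[where k = l and n = m])
       (use XY in \<open>auto simp: Y_def X_def intro!: arg_cong[where f = Determinant.det] eq_matI\<close>)
  also have "\<dots> = (- 1) ^ (l * m + m) * Determinant.det ?\<Phi>"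
    by (subst det_four_block_mat_upper_right_zero[where n = l and m = m])
       (use XY in \<open>auto simp: detX power_add\<close>)
  \<comment> \<open>The exponent is \<open>n l (l + 1)\<close>.\<close>
  also have "even (l * m + m)"
    by (auto simp: m_def)
  then have "(- 1) ^ (l * m + m) * Determinant.det ?\<Phi> = Determinant.det ?\<Phi>"
    by simp
  finally show ?thesis by (simp add: M_def)
qed

section \<open>The compressed shift\<close>

lemma mult_z_linear: "Vector_Spaces.linear vscale vscale mult_z"
  by unfold_locales (simp_all add: mult_z_def vscale_def vec_eq_iff algebra_simps)

lemma matrix_poly_monic:
  assumes "monic_of_degree n F"
  shows "matrix_poly F z $ a $ b = (if a = b then z ^ n else 0) + (\<Sum>r<n. z ^ r * coeff (F $ a $ b) r)"
proof -
  have F: "coeff (F $ a $ b) n = (if a = b then 1 else 0)" "degree (F $ a $ b) \<le> n"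
    using assms by (auto simp: monic_of_degree_def map_matrix_def vec_eq_iff mat_def)
  have "matrix_poly F z $ a $ b = (\<Sum>r\<le>degree (F $ a $ b). coeff (F $ a $ b) r * z ^ r)"
    by (simp add: matrix_poly_def map_matrix_def poly_altdef)
  also have "\<dots> = (\<Sum>r\<le>n. coeff (F $ a $ b) r * z ^ r)"
    using F(2) by (intro sum.mono_neutral_left) (auto simp: coeff_eq_0)
  finally show ?thesis
    by (simp add: F(1) mult.commute flip: lessThan_Suc_atMost)
qed

text \<open>In the monomial basis \<open>\<pi> M\<^sub>z \<pi>\<close> sends \<open>z\<^sup>k e\<^sub>a\<close> to \<open>z\<^sup>k\<^sup>+\<^sup>1 e\<^sub>a\<close> for \<open>k < n\<close>, and \<open>z\<^sup>n e\<^sub>a\<close> to the projection of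
  \<open>z\<^sup>n\<^sup>+\<^sup>1 e\<^sub>a\<close>, which is \<open>z\<^sup>n\<^sup>+\<^sup>1 e\<^sub>a\<close> minus the column \<open>a\<close> of \<open>\<Phi>\<^sub>n\<^sub>+\<^sub>1\<close>. Its matrix is therefore the block
  companion matrix of \<open>\<Phi>\<^sub>n\<^sub>+\<^sub>1\<close>.\<close>

lemma det_compressed_shift:
  fixes \<mu> :: "complex set \<Rightarrow> complex^'l^'l"
  assumes nt: "nontrivial_measure \<mu>" and \<epsilon>: "bij_betw \<epsilon> {0..<CARD('l)} (UNIV :: 'l set)"
  defines "l \<equiv> CARD('l)"
  shows "vpoly.det_on (Vpoly n)
      (\<lambda>f. vscale z f - ortho_proj \<mu> n (mult_z (ortho_proj \<mu> n f))) =
    Determinant.det (Matrix.mat (Suc n * l) (Suc n * l) (\<lambda>(i, j).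
      (if i = j then z else 0) - (if i = j + l then 1 else 0)
      + (if n * l \<le> j then coeff (Phi_R \<mu> (Suc n) $ \<epsilon> (i mod l) $ \<epsilon> (j - n * l)) (i div l) else 0)))"
    (is "vpoly.det_on _ ?S = Determinant.det ?M")
proof -
  let ?P = "ortho_proj \<mu> n"
  define N where "N = Suc n * l"
  define bs where "bs = map (monomial_basis \<epsilon>) [0..<N]"
  have nth: "length bs = N" "\<And>i. i < N \<Longrightarrow> bs ! i = monomial_basis \<epsilon> i"
    by (simp_all add: bs_def)
  have inj: "inj_on \<epsilon> {0..<CARD('l)}" using \<epsilon> by (rule bij_betw_imp_inj_on)
  have span: "vpoly.span (set bs) = Vpoly n"
    using span_monomial_basis[OF \<epsilon>, of n] by (simp add: bs_def N_def l_def atLeast0LessThan)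
  have dual: "coordinate \<epsilon> i (bs ! j) = (if i = j then 1 else 0)" if "i < length bs" "j < length bs" for i j
    using that by (simp add: nth coordinate_monomial_basis[OF inj])
  note basis = vpoly.dual_functionals_representation[OF coordinate_linear dual, unfolded span]
  have ob: "vpoly.ordered_basis bs (Vpoly n)"
    using basis(1,2) span by (simp add: vpoly.ordered_basis_def)
  interpret P: Vector_Spaces.linear vscale vscale ?P by (rule ortho_proj_linear[OF nt])
  interpret Z: Vector_Spaces.linear vscale vscale mult_z by (rule mult_z_linear)
  have lin: "Vector_Spaces.linear vscale vscale ?S"
    by unfold_locales (simp_all add: P.add Z.add P.scale Z.scale vpoly.scale_right_distrib
        vpoly.scale_right_diff_distrib vpoly.scale_left_commute)
  have SV: "?S f \<in> Vpoly n" if "f \<in> Vpoly n" for f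
    using that ortho_proj(1)[OF nt]
    by (intro vpoly.subspace_diff[OF subspace_Vpoly] vpoly.subspace_scale[OF subspace_Vpoly])
  have entry: "coordinate \<epsilon> i (?S (monomial_basis \<epsilon> j)) =
      (if i = j then z else 0) - (if i = j + l then 1 else 0)
      + (if n * l \<le> j then coeff (Phi_R \<mu> (Suc n) $ \<epsilon> (i mod l) $ \<epsilon> (j - n * l)) (i div l) else 0)"
    if ij: "i < N" "j < N" for i j
  proof -
    interpret C: Vector_Spaces.linear vscale "(*)" "coordinate \<epsilon> i" by (rule coordinate_linear)
    have "?P (monomial_basis \<epsilon> j) = monomial_basis \<epsilon> j"
      using ij by (intro ortho_proj_id[OF nt] monomial_basis_in_Vpoly) (simp add: N_def l_def)
    then have S: "?S (monomial_basis \<epsilon> j) =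
        vscale z (monomial_basis \<epsilon> j) - ?P (monomial_basis \<epsilon> (j + l))"
      by (simp add: l_def monomial_basis_add_card)
    have P: "coordinate \<epsilon> i (?P (monomial_basis \<epsilon> (j + l))) = (if i = j + l then 1 else 0)
        - (if n * l \<le> j then coeff (Phi_R \<mu> (Suc n) $ \<epsilon> (i mod l) $ \<epsilon> (j - n * l)) (i div l) else 0)"
    proof (cases "n * l \<le> j")
      case False
      then have "?P (monomial_basis \<epsilon> (j + l)) = monomial_basis \<epsilon> (j + l)"
        by (intro ortho_proj_id[OF nt] monomial_basis_in_Vpoly) (simp add: l_def)
      then show ?thesis using False by (simp add: coordinate_monomial_basis[OF inj])
    next
      case True
      define b where "b = j - n * l"
      have b: "b < l" "j + l = Suc n * l + b" using True ij by (auto simp: b_def N_def)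
      then have top: "monomial_basis \<epsilon> (j + l) = axis (\<epsilon> b) (monom 1 (Suc n))"
        unfolding b(2) monomial_basis_def l_def[symmetric]
        by (metis add.commute div_mult_self3 div_less mod_mult_self3 mod_less mult.commute add_0 less_nat_zero_code)
      have "?P (monomial_basis \<epsilon> (j + l)) = monomial_basis \<epsilon> (j + l) - (\<chi> i. Phi_R \<mu> (Suc n) $ i $ \<epsilon> b)"
        unfolding top Phi_R_column(2)[OF nt] by simp
      then show ?thesis
        using True by (simp add: C.diff coordinate_monomial_basis[OF inj] b_def)
          (simp add: coordinate_def l_def)
    qed
    show ?thesis
      unfolding S by (simp add: C.diff C.scale P coordinate_monomial_basis[OF inj])
  qed
  have "vpoly.operator_matrix bs ?S = ?M"
  proof (rule eq_matI)
    fix i j assume "i < dim_row ?M" "j < dim_col ?M"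
    then have ij: "i < N" "j < N" by (simp_all add: N_def)
    have "?S (monomial_basis \<epsilon> j) \<in> Vpoly n"
      using ij by (intro SV monomial_basis_in_Vpoly) (simp add: N_def l_def)
    from basis(3)[OF _ _ this, of i] ij
    show "vpoly.operator_matrix bs ?S $$ (i, j) = ?M $$ (i, j)"
      by (simp add: vpoly.operator_matrix_def nth entry N_def[symmetric] del: mult_Suc)
  qed (simp_all add: vpoly.operator_matrix_def nth N_def)
  then show ?thesis
    using vpoly.det_on_eq[OF ob lin] SV by (simp add: image_subset_iff)
qed

theorem theorem3p10:
  fixes \<mu> :: "complex set \<Rightarrow> complex^'l^'l" and n :: nat and z :: complex
  assumes "matrix_measure \<mu>"
    and "\<mu> (sphere 0 1) = mat 1"
    and "nontrivial_measure \<mu>"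
    and "n \<ge> 1"
  shows "Determinants.det (matrix_poly (Phi_R \<mu> n) z) =
    vpoly.det_on (Vpoly (n - 1))
      (\<lambda>f. vscale z f - ortho_proj \<mu> (n - 1) (mult_z (ortho_proj \<mu> (n - 1) f)))"
proof -
  obtain m where n: "n = Suc m"
    using \<open>n \<ge> 1\<close> by (cases n) auto
  obtain \<epsilon> :: "nat \<Rightarrow> 'l" where \<epsilon>: "bij_betw \<epsilon> {0..<CARD('l)} UNIV"
    using ex_enumeration by blast
  have "\<epsilon> i = \<epsilon> j \<longleftrightarrow> i = j" if "i < CARD('l)" "j < CARD('l)" for i j
    using that bij_betw_imp_inj_on[OF \<epsilon>] by (auto dest: inj_onD)
  then have "Matrix.mat CARD('l) CARD('l) (\<lambda>(i, j). matrix_poly (Phi_R \<mu> n) z $ \<epsilon> i $ \<epsilon> j) =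
      Matrix.mat CARD('l) CARD('l) (\<lambda>(i, j). (if i = j then z ^ Suc m else 0)
        + (\<Sum>r<Suc m. z ^ r * coeff (Phi_R \<mu> (Suc m) $ \<epsilon> i $ \<epsilon> j) r))"
    unfolding n
    by (intro eq_matI) (simp_all add: matrix_poly_monic[OF Phi_R_column(1)[OF assms(3)]]
        del: sum.lessThan_Suc)
  with det_mat_eq_det_vec[OF \<epsilon>, of "matrix_poly (Phi_R \<mu> n) z"]
    det_compressed_shift[OF assms(3) \<epsilon>, of m z]
    det_block_companion[of "CARD('l)" m z "\<lambda>r i j. coeff (Phi_R \<mu> (Suc m) $ \<epsilon> i $ \<epsilon> j) r"]
  show ?thesis
    by (simp add: n del: sum.lessThan_Suc mult_Suc)
qed

end
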